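(* There is no function $\psi:T\to\mathbb{C}$ such that $M_\psi$ is an isometry from $\mathcal{L}_{\mathbf{w}}$ to $L^\infty$, and there is no function $\psi:T\to\mathbb{C}$ such that $M_\psi$ is an isometry from $\mathcal{L}_{\mathbf{w},0}$ to $L^\infty$.
   Context: $T$ is the vertex set of a tree (a locally finite, connected, simply connected graph), rooted at a vertex $o$ and without terminal vertices (a terminal vertex is one having a unique neighbor), hence infinite. $|v|$ is the number of edges in the path from $o$ to $v$; $T^*=T\setminus\{o\}$; for $v\in T^*$, $v^-$ is the neighbor of $v$ closest to $o$. For $f:T\to\mathbb{C}$ and $v\in T^*$, $Df(v)=|f(v)-f(v^-)|$. The weighted Lipschitz space $\mathcal{L}_{\mathbf{w}}$ is the Banach space of all $f:T\to\mathbb{C}$ with $\sup_{v\in T^*}|v|Df(v)<\infty$, with norm $\|f\|_{\mathbf{w}}=|f(o)|+\sup_{v\in T^*}|v|Df(v)$; the little weighted Lipschitz space is the closed subspace $\mathcal{L}_{\mathbf{w},0}=\{f\in\mathcal{L}_{\mathbf{w}}:\lim_{|v|\to\infty}|v|Df(v)=0\}$. $L^\infty$ is the Banach space of bounded functions $f:T\to\mathbb{C}$ with $\|f\|_\infty=\sup_{v\in T}|f(v)|$. For $\psi:T\to\mathbb{C}$, $M_\psi f=\psi f$ (pointwise product). $M_\psi$ is an isometry from $X$ to $Y$ if $\psi f\in Y$ and $\|\psi f\|_Y=\|f\|_X$ for all $f\in X$. *)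

theory Defs
  imports Complex_Main
begin

text \<open>
  The vertex set \<open>T\<close> is the whole type \<open>'a\<close>, so that functions on \<open>T\<close> are exactly the
  functions of type \<open>'a \<Rightarrow> complex\<close>; \<open>E\<close> is the adjacency relation and \<open>r\<close> the root.
\<close>

definition is_path :: "('a \<Rightarrow> 'a \<Rightarrow> bool) \<Rightarrow> 'a \<Rightarrow> 'a list \<Rightarrow> 'a \<Rightarrow> bool" where
  "is_path E u p v \<longleftrightarrow> p \<noteq> [] \<and> hd p = u \<and> last p = v \<and> distinct p \<and> successively E p"

text \<open>Every pair of adjacent vertices is a path that closes up, hence the length bound.\<close>

definition is_cycle :: "('a \<Rightarrow> 'a \<Rightarrow> bool) \<Rightarrow> 'a list \<Rightarrow> bool" where
  "is_cycle E p \<longleftrightarrow> length p \<ge> 3 \<and> distinct p \<and> successively E p \<and> E (last p) (hd p)"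

text \<open>
  The one-vertex tree has no terminal vertex either, so infinitude does not follow from the
  other assumptions and is required separately.
\<close>

locale infinite_tree =
  fixes E :: "'a \<Rightarrow> 'a \<Rightarrow> bool"
  assumes symmetric: "E u v \<Longrightarrow> E v u"
    and loopfree: "\<not> E v v"
    and locally_finite: "finite {w. E v w}"
    and connected: "\<exists>p. is_path E u p v"
    and simply_connected: "\<not> is_cycle E p"
    and no_terminal: "\<not> (\<exists>!w. E v w)"
    and infinite_vertices: "infinite (UNIV :: 'a set)"

definition depth :: "('a \<Rightarrow> 'a \<Rightarrow> bool) \<Rightarrow> 'a \<Rightarrow> 'a \<Rightarrow> nat" where
  "depth E r v = length (THE p. is_path E r p v) - 1"

definition parent :: "('a \<Rightarrow> 'a \<Rightarrow> bool) \<Rightarrow> 'a \<Rightarrow> 'a \<Rightarrow> 'a" where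
  "parent E r v = (THE w. is_arg_min (depth E r) (E v) w)"

definition diff_abs :: "('a \<Rightarrow> 'a \<Rightarrow> bool) \<Rightarrow> 'a \<Rightarrow> ('a \<Rightarrow> complex) \<Rightarrow> 'a \<Rightarrow> real" where
  "diff_abs E r f v = cmod (f v - f (parent E r v))"

definition wLip :: "('a \<Rightarrow> 'a \<Rightarrow> bool) \<Rightarrow> 'a \<Rightarrow> ('a \<Rightarrow> complex) set" where
  "wLip E r = {f. bdd_above ((\<lambda>v. real (depth E r v) * diff_abs E r f v) ` (UNIV - {r}))}"

definition wLip_norm :: "('a \<Rightarrow> 'a \<Rightarrow> bool) \<Rightarrow> 'a \<Rightarrow> ('a \<Rightarrow> complex) \<Rightarrow> real" where
  "wLip_norm E r f = cmod (f r) + (SUP v \<in> UNIV - {r}. real (depth E r v) * diff_abs E r f v)"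

text \<open>
  The filter \<open>filtercomap (depth E r) at_top\<close> expresses \<open>|v| \<rightarrow> \<infinity>\<close>. The root does not
  matter here, as eventually the depth is positive.
\<close>

definition wLip0 :: "('a \<Rightarrow> 'a \<Rightarrow> bool) \<Rightarrow> 'a \<Rightarrow> ('a \<Rightarrow> complex) set" where
  "wLip0 E r = {f \<in> wLip E r.
     ((\<lambda>v. real (depth E r v) * diff_abs E r f v) \<longlongrightarrow> 0) (filtercomap (depth E r) at_top)}"

definition Linf :: "('a \<Rightarrow> complex) set" where
  "Linf = {f. bdd_above (range (\<lambda>v. cmod (f v)))}"

definition Linf_norm :: "('a \<Rightarrow> complex) \<Rightarrow> real" where
  "Linf_norm f = (SUP v. cmod (f v))"

definition mult_op :: "('a \<Rightarrow> complex) \<Rightarrow> ('a \<Rightarrow> complex) \<Rightarrow> 'a \<Rightarrow> complex" where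
  "mult_op \<psi> f = (\<lambda>v. \<psi> v * f v)"

definition is_isometry ::
    "'f set \<Rightarrow> ('f \<Rightarrow> real) \<Rightarrow> 'g set \<Rightarrow> ('g \<Rightarrow> real) \<Rightarrow> ('f \<Rightarrow> 'g) \<Rightarrow> bool" where
  "is_isometry X normX Y normY A \<longleftrightarrow> (\<forall>f\<in>X. A f \<in> Y \<and> normY (A f) = normX f)"

end

theory Submission
  imports Defs
begin

text \<open>
  The constant function 1 has norm 1, so an isometric multiplier \<open>\<psi>\<close> satisfies
  \<open>cmod (\<psi> r) \<le> 1\<close>. The indicator function of the root \<open>r\<close> lies in the little space and has
  norm 2, the second unit coming from the edges at \<open>r\<close>, so that \<open>cmod (\<psi> r) = 2\<close>.
\<close>

context infinite_tree
begin

lemma path_exists: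
  obtains p where "is_path E u p v"
  using connected by blast

lemma path_unique:
  assumes "is_path E u p v" "is_path E u q v"
  shows "p = q"
  using assms
proof (induction p arbitrary: u q)
  case Nil
  then show ?case by (simp add: is_path_def)
next
  case (Cons a p)
  have [simp]: "a = u" using Cons.prems by (simp add: is_path_def)
  obtain q' where q: "q = u # q'" using Cons.prems(2) by (cases q) (auto simp: is_path_def)
  show ?case
  \<comment> \<open>If one path is just \<open>[u]\<close>, then \<open>v = u\<close>, and
    distinctness forces the other to be \<open>[u]\<close> too.\<close>
  proof (cases "p = [] \<or> q' = []")
    case True
    then show ?thesis
      using Cons.prems q by (auto simp: is_path_def split: if_splits)
  next
    case False
    have p': "is_path E (hd p) p v" and q': "is_path E (hd q') q' v"
      and u: "u \<notin> set p" "u \<notin> set q'" "E u (hd p)" "E u (hd q')"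
      using Cons.prems q False by (auto simp: is_path_def successively_Cons)
    show ?thesis
    proof (cases "hd p = hd q'")
      case True
      then show ?thesis using Cons.IH[OF p'] q' q by simp
    next
      case neq: False
      have "\<exists>x\<in>set p. x \<in> set q'"
        using p' q' by (auto simp: is_path_def intro: last_in_set)
      \<comment> \<open>Taking the first vertex \<open>x\<close> of \<open>p\<close> that lies on
        \<open>q'\<close> keeps \<open>p1\<close> disjoint from \<open>q'\<close>, so the closed
        walk below repeats no vertex.\<close>
      then obtain p1 x p2 where p12: "p = p1 @ x # p2" "x \<in> set q'" "\<forall>y\<in>set p1. y \<notin> set q'"
        by (rule split_list_first_propE)
      obtain q1 q2 where q12: "q' = q1 @ x # q2"
        using split_list[OF p12(2)] by blast
      have flip: "(\<lambda>y x. E x y) = E" by (intro ext iffI; erule symmetric)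
      \<comment> \<open>Out along \<open>p\<close> to \<open>x\<close>, then back along
        \<open>q'\<close>.\<close>
      let ?c = "u # p1 @ x # rev q1"
      have "successively E (p1 @ [x])"
        using p' p12 by (auto simp: is_path_def successively_append_iff)
      moreover have "successively E (x # rev q1)"
      proof -
        have "successively E (q1 @ [x])"
          using q' q12 by (auto simp: is_path_def successively_append_iff)
        then have "successively E (rev (q1 @ [x]))" by (simp only: successively_rev flip)
        then show ?thesis by simp
      qed
      ultimately have "successively E ?c"
        using u(3) p12 by (cases p1) (auto simp: successively_Cons successively_append_iff hd_append split: if_splits)
      moreover have "distinct ?c"
        using p' q' u p12 q12 by (auto simp: is_path_def)
      moreover have "E (last ?c) (hd ?c)"
        using symmetric[OF u(4)] q12 by (cases q1) auto
      \<comment> \<open>\<open>p1\<close> and \<open>q1\<close> are not both empty: otherwise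
        \<open>x\<close> would be the head of both \<open>p\<close> and \<open>q'\<close>.\<close>
      moreover have "length ?c \<ge> 3"
        using neq p12 q12 by (cases p1; cases q1) auto
      ultimately have "is_cycle E ?c" by (simp add: is_cycle_def)
      with simply_connected show ?thesis by blast
    qed
  qed
qed

lemma depth_path:
  assumes "is_path E u p v"
  shows "depth E u v = length p - 1"
proof -
  have "(THE q. is_path E u q v) = p"
    using assms path_unique[OF _ assms] by (rule the_equality)
  then show ?thesis by (simp add: depth_def)
qed

lemma depth_root: "depth E u u = 0"
  using depth_path[of u "[u]" u] by (simp add: is_path_def)

lemma depth_eq_0_iff: "depth E u v = 0 \<longleftrightarrow> v = u"
proof
  assume 0: "depth E u v = 0"
  obtain p where p: "is_path E u p v" by (rule path_exists)
  with 0 depth_path have "length p \<le> 1" by fastforce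
  with p show "v = u" by (cases p) (auto simp: is_path_def)
qed (simp add: depth_root)

text \<open>The parent is the penultimate vertex \<open>w\<close> of the path to \<open>v\<close>.
  The path to any other neighbor of \<open>v\<close> passes through \<open>v\<close>, so
  \<open>w\<close> is the only neighbor of minimal depth and the description in
  \<open>parent\<close> is well defined.\<close>

lemma parent_edge_depth:
  assumes "v \<noteq> u"
  shows "E v (parent E u v) \<and> depth E u v = Suc (depth E u (parent E u v))"
proof -
  obtain p where p: "is_path E u p v" by (rule path_exists)
  define q where "q = butlast p"
  have pq: "p = q @ [v]" "q \<noteq> []"
    using p assms unfolding is_path_def q_def
    by (metis append_butlast_last_id, metis append_butlast_last_id append_Nil list.sel(1))
  define w where "w = last q"
  have w: "is_path E u q w" "E v w"
    using p pq symmetric by (auto simp: is_path_def w_def successively_append_iff)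
  have dw: "depth E u v = Suc (depth E u w)"
    using depth_path[OF p] depth_path[OF w(1)] pq by simp
  have other: "depth E u w < depth E u x" if x: "E v x" "x \<noteq> w" for x
  proof -
    obtain s where s: "is_path E u s x" by (rule path_exists)
    \<comment> \<open>Otherwise appending \<open>v\<close> to \<open>s\<close> would give a path to
      \<open>v\<close> with penultimate vertex \<open>x\<close> instead of \<open>w\<close>.\<close>
    have "v \<in> set s"
    proof (rule ccontr)
      assume "v \<notin> set s"
      then have "is_path E u (s @ [v]) v"
        using s x symmetric by (auto simp: is_path_def successively_append_iff)
      from path_unique[OF p this] have "s = q" using pq by simp
      then show False using s x w_def by (simp add: is_path_def)
    qed
    then obtain s1 s2 where s12: "s = s1 @ v # s2" by (meson split_list)
    moreover from this have "successively E ((s1 @ [v]) @ s2)" using s by (simp add: is_path_def)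
    then have "successively E (s1 @ [v])" by (simp only: successively_append_iff)
    ultimately have "is_path E u (s1 @ [v]) v"
      using s by (cases s1) (auto simp: is_path_def)
    \<comment> \<open>So \<open>s\<close> extends \<open>p\<close> itself and is longer than
      \<open>q\<close>.\<close>
    from path_unique[OF p this] have "s1 = q" using pq by simp
    then show ?thesis
      using depth_path[OF s] depth_path[OF w(1)] s12 pq(2) by (cases q) auto
  qed
  have "parent E u v = w"
    unfolding parent_def
    by (rule the_equality) (use w other in \<open>auto simp: is_arg_min_def dest: less_asym\<close>)
  then show ?thesis using w dw by simp
qed

lemma parent_eq_root_iff:
  assumes "v \<noteq> u"
  shows "parent E u v = u \<longleftrightarrow> depth E u v = 1"
  using parent_edge_depth[OF assms] depth_eq_0_iff by auto

text \<open>The second vertex of a path from \<open>u\<close> to any other vertex serves.\<close>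

lemma root_neighbour:
  obtains v where "v \<noteq> u" "depth E u v = 1"
proof -
  obtain v where "v \<noteq> u"
    using ex_new_if_finite[OF infinite_vertices, of "{u}"] by auto
  obtain p where p: "is_path E u p v" by (rule path_exists)
  then obtain w p' where "p = u # w # p'"
    using \<open>v \<noteq> u\<close> unfolding is_path_def by (metis last.simps list.exhaust_sel)
  with p have "is_path E u [u, w] w" by (auto simp: is_path_def)
  from depth_path[OF this] have "depth E u w = 1" by simp
  then show thesis using that[of w] depth_root by force
qed

text \<open>The indicator changes only along the edges at \<open>u\<close>, where the weight is
  1.\<close>

lemma weighted_diff_indicator_root:
  assumes "v \<noteq> u"
  shows "real (depth E u v) * diff_abs E u (\<lambda>x. if x = u then 1 else 0) v
           = (if depth E u v = 1 then 1 else 0)"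
  using assms parent_eq_root_iff[OF assms] by (auto simp: diff_abs_def)

lemma indicator_root_in_wLip0: "(\<lambda>x. if x = u then 1 else 0) \<in> wLip0 E u"
proof -
  let ?h = "\<lambda>v. real (depth E u v) * diff_abs E u (\<lambda>x. if x = u then 1 else 0) v"
  have "bdd_above (?h ` (UNIV - {u}))"
  proof (rule bdd_aboveI2)
    fix v assume "v \<in> UNIV - {u}"
    then show "?h v \<le> 1" by (subst weighted_diff_indicator_root) auto
  qed
  moreover have "\<forall>\<^sub>F v in filtercomap (depth E u) at_top. ?h v = 0"
    unfolding eventually_filtercomap_at_top_linorder
  proof (intro exI allI impI)
    \<comment> \<open>The bound 2 excludes the neighbors of \<open>u\<close> as well as
      \<open>u\<close> itself, to which the formula above does not apply.\<close>
    fix v assume "2 \<le> depth E u v"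
    then show "?h v = 0"
      using weighted_diff_indicator_root[of v u] depth_eq_0_iff[of u v] by fastforce
  qed
  then have "(?h \<longlongrightarrow> 0) (filtercomap (depth E u) at_top)"
    by (rule tendsto_eventually)
  ultimately show ?thesis by (simp add: wLip0_def wLip_def)
qed

lemma wLip_norm_indicator_root: "wLip_norm E u (\<lambda>x. if x = u then 1 else 0) = 2"
proof -
  obtain v where v: "v \<noteq> u" "depth E u v = 1" by (rule root_neighbour)
  have "(SUP v\<in>UNIV - {u}. real (depth E u v) * diff_abs E u (\<lambda>x. if x = u then 1 else 0) v) = 1"
    by (rule cSup_eq_maximum)
      (use v in \<open>auto simp: weighted_diff_indicator_root intro!: image_eqI[where x = v]\<close>)
  then show ?thesis by (simp add: wLip_norm_def)
qed

lemma one_in_wLip0: "(\<lambda>_. 1) \<in> wLip0 E u"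
  by (simp add: wLip0_def wLip_def diff_abs_def bdd_aboveI2[where M = 0])

lemma wLip_norm_one: "wLip_norm E u (\<lambda>_. 1) = 1"
proof -
  obtain v where "v \<noteq> u" using root_neighbour .
  \<comment> \<open>Nonemptiness matters: only then is the supremum of the constant 0 known to be
    0.\<close>
  then have "UNIV - {u} \<noteq> {}" by blast
  then show ?thesis by (simp add: wLip_norm_def diff_abs_def)
qed

text \<open>Both test functions lie in the little space, so a general \<open>X\<close> above it
  covers both spaces at once.\<close>

lemma no_isometry:
  assumes "wLip0 E u \<subseteq> X" "is_isometry X (wLip_norm E u) Linf Linf_norm (mult_op \<psi>)"
  shows False
proof -
  have isom: "mult_op \<psi> f \<in> Linf" "Linf_norm (mult_op \<psi> f) = wLip_norm E u f"
    if "f \<in> wLip0 E u" for f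
    using assms that by (auto simp: is_isometry_def)
  \<comment> \<open>A value is below the real supremum only if the range is bounded, hence the
    appeal to membership in \<open>Linf\<close>.\<close>
  have "cmod (mult_op \<psi> (\<lambda>_. 1) u) \<le> Linf_norm (mult_op \<psi> (\<lambda>_. 1))"
    using isom(1)[OF one_in_wLip0] unfolding Linf_norm_def Linf_def by (auto intro: cSUP_upper)
  then have "cmod (\<psi> u) \<le> 1"
    using isom(2)[OF one_in_wLip0] by (simp add: wLip_norm_one mult_op_def)
  moreover have "Linf_norm (mult_op \<psi> (\<lambda>x. if x = u then 1 else 0)) \<le> cmod (\<psi> u)"
    unfolding Linf_norm_def by (rule cSUP_least) (auto simp: mult_op_def)
  ultimately show False
    using isom(2)[OF indicator_root_in_wLip0] by (simp add: wLip_norm_indicator_root)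
qed

end

theorem theorem4p3:
  fixes E :: "'a \<Rightarrow> 'a \<Rightarrow> bool" and r :: 'a
  assumes "infinite_tree E"
  shows "(\<nexists>\<psi> :: 'a \<Rightarrow> complex.
            is_isometry (wLip E r) (wLip_norm E r) Linf Linf_norm (mult_op \<psi>))
       \<and> (\<nexists>\<psi> :: 'a \<Rightarrow> complex.
            is_isometry (wLip0 E r) (wLip_norm E r) Linf Linf_norm (mult_op \<psi>))"
proof -
  interpret infinite_tree E by fact
  have "wLip0 E r \<subseteq> wLip E r" by (auto simp: wLip0_def)
  then show ?thesis using no_isometry by blast
qed

end
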